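(* For $k=2$, \[ z_{f_2}^2=\frac12\left[\sqrt{\left\{\frac12\left(\frac{M_2}{m_2}-1\right)\right\}^2+\frac{M_1}{m_1}}+\frac12\left(\frac{M_2}{m_2}+1\right)\right]. \]
   Context: Fix reals $0<m_1\le M_1$ and $0<m_2\le M_2$ with $M_1/m_1\ge M_2/m_2$ (standing assumption of the paper). Let $f_2(c_1,c_2)=(c_1+c_2)/2$. Let $\mathcal{S}_{f_2}^2=\{(x_1,x_2)\in[m_1,M_1]\times[m_2,M_2]: \frac12(M_1/x_1+M_2/x_2)=\frac12(x_1/m_1+x_2/m_2)\}$ and $z_{f_2}^2=\sup_{(x_1,x_2)\in\mathcal{S}_{f_2}^2}\frac12(M_1/x_1+M_2/x_2)$. *)

theory Defs
  imports Complex_Main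
begin

definition f2 :: "real \<Rightarrow> real \<Rightarrow> real" where
  "f2 c1 c2 = (c1 + c2) / 2"

definition S2 :: "(real \<Rightarrow> real \<Rightarrow> real) \<Rightarrow> real \<Rightarrow> real \<Rightarrow> real \<Rightarrow> real \<Rightarrow> (real \<times> real) set" where
  "S2 f m1 M1 m2 M2 =
     {(x1, x2) \<in> {m1..M1} \<times> {m2..M2}. f (M1 / x1) (M2 / x2) = f (x1 / m1) (x2 / m2)}"

(* The real Sup is meaningful only for nonempty sets that are bounded above.  For f = f2 and
   0 < m1 <= M1, 0 < m2 <= M2 both hold: (sqrt (m1 * M1), sqrt (m2 * M2)) lies in S2, and
   M1 / m1, M2 / m2 bound the two arguments of f. *)
definition z2 :: "(real \<Rightarrow> real \<Rightarrow> real) \<Rightarrow> real \<Rightarrow> real \<Rightarrow> real \<Rightarrow> real \<Rightarrow> real" where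
  "z2 f m1 M1 m2 M2 = (SUP (x1, x2) \<in> S2 f m1 M1 m2 M2. f (M1 / x1) (M2 / x2))"

end

theory Submission imports Defs begin

text \<open>Put A = M1/m1, B = M2/m2, u = x1/m1, v = x2/m2 and let s = u + v = A/u + B/v be twice
  the objective. Multiplying s - v = u by s - B/v = A/u eliminates u and leaves the quadratic
  s^2 - s (v + B/v) + B = A. On [1, B] one has v + B/v \<le> B + 1, with equality at v = 1, so s is
  at most the larger root of s^2 - (B + 1) s + B - A, and this root is attained at v = 1.\<close>

lemma balanced_sum_le:
  fixes A B u v :: real
  assumes "0 < u" "1 \<le> v" "v \<le> B" and eq: "A / u + B / v = u + v"
  shows "u + v \<le> sqrt (((B - 1) / 2)\<^sup>2 + A) + (B + 1) / 2"
proof -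
  define s where "s = u + v"
  have "0 < v" "0 \<le> s"
    using assms by (auto simp: s_def)
  have "s - v = u" "s - B / v = A / u"
    using eq by (auto simp: s_def)
  then have "(s - v) * (s - B / v) = u * (A / u)"
    by (simp only:)
  also have "\<dots> = A"
    using \<open>0 < u\<close> by simp
  finally have "s * s - s * (v + B / v) + v * (B / v) = A"
    by (simp only: algebra_simps)
  then have quadratic: "s * s - s * (v + B / v) + B = A"
    using \<open>0 < v\<close> by simp
  \<comment> \<open>Expanding the product and dividing by \<open>v\<close> turns the range condition
    on \<open>v\<close> into the bound on \<open>v + B / v\<close>.\<close>
  have "0 \<le> (v - 1) * (B - v)"
    using assms by simp
  then have "v + B / v \<le> B + 1"
    using \<open>0 < v\<close> by (simp add: field_simps)
  then have "s * (v + B / v) \<le> s * (B + 1)"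
    using \<open>0 \<le> s\<close> by (rule mult_left_mono)
  \<comment> \<open>Completes the square, using
    \<open>((B + 1) / 2)\<^sup>2 - B = ((B - 1) / 2)\<^sup>2\<close>.\<close>
  with quadratic have "(s - (B + 1) / 2)\<^sup>2 \<le> ((B - 1) / 2)\<^sup>2 + A"
    by (simp add: power2_eq_square field_simps)
  then have "s - (B + 1) / 2 \<le> sqrt (((B - 1) / 2)\<^sup>2 + A)"
    by (rule real_le_rsqrt)
  then show ?thesis
    by (simp add: s_def)
qed

text \<open>At \<open>v = 1\<close> the balance equation becomes \<open>A / u + B = u + 1\<close>,
  whose positive root is \<open>t\<close>. The two bounds keep this root in the range allowed for
  \<open>u\<close>, so the supremum is attained.\<close>

lemma balanced_root:
  fixes A B :: real
  assumes "1 \<le> B" "B \<le> A"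
  defines "t \<equiv> sqrt (((B - 1) / 2)\<^sup>2 + A) + (B - 1) / 2"
  shows "1 \<le> t" "t \<le> A" "A / t + B = t + 1"
proof -
  have "1 \<le> sqrt (((B - 1) / 2)\<^sup>2 + A)"
    using assms by (intro real_le_rsqrt) (simp add: add_increasing)
  then show "1 \<le> t"
    using assms(1) unfolding t_def by (intro add_increasing2) simp_all
  \<comment> \<open>The difference of the two sides of the squared bound below is exactly
    \<open>A * A - A * B\<close>; this is where the ordering of the two ratios enters.\<close>
  have "A * B \<le> A * A"
    using assms by (intro mult_left_mono) auto
  then have "((B - 1) / 2)\<^sup>2 + A \<le> (A - (B - 1) / 2)\<^sup>2"
    by (simp add: power2_eq_square field_simps)
  then have "sqrt (((B - 1) / 2)\<^sup>2 + A) \<le> A - (B - 1) / 2"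
    using assms by (intro real_le_lsqrt) auto
  then show "t \<le> A"
    by (simp add: t_def)
  have "(t - (B - 1) / 2)\<^sup>2 = ((B - 1) / 2)\<^sup>2 + A"
    using assms by (simp add: t_def)
  then have "A = t * (t + 1 - B)"
    by (simp add: power2_eq_square field_simps)
  then show "A / t + B = t + 1"
    using \<open>1 \<le> t\<close> by simp
qed

theorem theorem5:
  fixes m1 M1 m2 M2 :: real
  assumes "0 < m1" and "m1 \<le> M1"
    and "0 < m2" and "m2 \<le> M2"
    and "M1 / m1 \<ge> M2 / m2"
  shows "z2 f2 m1 M1 m2 M2 =
    1 / 2 * (sqrt ((1 / 2 * (M2 / m2 - 1))\<^sup>2 + M1 / m1) + 1 / 2 * (M2 / m2 + 1))"
proof -
  define A B where "A = M1 / m1" and "B = M2 / m2"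
  define t where "t = sqrt (((B - 1) / 2)\<^sup>2 + A) + (B - 1) / 2"
  have M: "M1 = A * m1" "M2 = B * m2"
    using assms by (auto simp: A_def B_def)
  have AB: "1 \<le> B" "B \<le> A"
    using assms by (auto simp: A_def B_def)
  have t: "1 \<le> t" "t \<le> A" "A / t + B = t + 1"
    using balanced_root[OF AB] by (auto simp: t_def)
  have "z2 f2 m1 M1 m2 M2 = (t + 1) / 2"
    unfolding z2_def
  proof (rule cSup_eq_maximum)
    \<comment> \<open>The maximizer is \<open>u = t\<close>, \<open>v = 1\<close> in original
      coordinates. Reading \<open>t(3)\<close> backwards replaces \<open>t + 1\<close> by
      \<open>A / t + B\<close>.\<close>
    have attained: "f2 (M1 / (t * m1)) (M2 / m2) = (t + 1) / 2"
      using assms t by (simp add: f2_def M flip: t(3))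
    moreover have "f2 (t * m1 / m1) (m2 / m2) = (t + 1) / 2"
      using assms by (simp add: f2_def)
    ultimately have "(t * m1, m2) \<in> S2 f2 m1 M1 m2 M2"
      using assms t AB by (simp add: S2_def M)
    with attained show "(t + 1) / 2 \<in> (\<lambda>(x1, x2). f2 (M1 / x1) (M2 / x2)) ` S2 f2 m1 M1 m2 M2"
      by (force intro!: image_eqI[where x = "(t * m1, m2)"])
  next
    fix y
    assume "y \<in> (\<lambda>(x1, x2). f2 (M1 / x1) (M2 / x2)) ` S2 f2 m1 M1 m2 M2"
    then obtain x1 x2 where x: "m1 \<le> x1" "m2 \<le> x2" "x2 \<le> M2"
        and balance: "f2 (M1 / x1) (M2 / x2) = f2 (x1 / m1) (x2 / m2)"
        and y: "y = f2 (M1 / x1) (M2 / x2)"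
      by (auto simp: S2_def)
    have eq: "M1 / x1 + M2 / x2 = x1 / m1 + x2 / m2"
      using balance unfolding f2_def by argo
    \<comment> \<open>By \<open>eq\<close> this sum is twice \<open>y\<close>, and the bound on it
      equals \<open>t + 1\<close> since \<open>(B + 1) / 2 = (B - 1) / 2 + 1\<close>.\<close>
    have "x1 / m1 + x2 / m2 \<le> sqrt (((B - 1) / 2)\<^sup>2 + A) + (B + 1) / 2"
    proof (rule balanced_sum_le)
      show "0 < x1 / m1" "1 \<le> x2 / m2" "x2 / m2 \<le> B"
        using assms x by (auto simp: B_def divide_right_mono)
      show "A / (x1 / m1) + B / (x2 / m2) = x1 / m1 + x2 / m2"
        using eq by (simp add: M)
    qed
    also have "\<dots> = t + 1"
      by (simp add: t_def field_simps)
    finally show "y \<le> (t + 1) / 2"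
      unfolding y f2_def eq by (rule divide_right_mono) simp
  qed
  then show ?thesis
    by (simp add: t_def A_def B_def field_simps)
qed

end
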